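(* Let $(X_i,d_i,\star_i)_{i\in\mathbb{N}}$ be pointed metric spaces and assume that $\pi_{i+1}:(X_{i+1},\star_{i+1})\to(X_i,\star_i)$ is base-point-preserving and has the unique path lifting property for every $i\in\mathbb{N}$. Then $\pi^\infty_i:X_\infty\to X_i$ also has the unique path lifting property for every $i\in\mathbb{N}$.
   Context: $\mathbb{N}=\{1,2,\dots\}$. Paths are continuous maps from compact intervals; $L$ denotes length, and a path is rectifiable if $L<\infty$. A submetry is a 1-Lipschitz map $\pi:X\to Y$ between nonempty metric spaces such that for any $y,y'\in Y$ and $x\in X$ with $\pi(x)=y$ there is $x'\in X$ with $\pi(x')=y'$ and $d_X(x,x')=d_Y(y,y')$. A submetry $\pi:X\to Y$ has the unique path lifting property (being a submetry is part of the property) if for every rectifiable path $\gamma:[a,b]\to Y$ and each $x\in\pi^{-1}(\gamma(a))$ there is a path $\bar\gamma:[a,b]\to X$ such that (1) $L(\bar\gamma)<\infty$; (2) $\bar\gamma(a)=x$; (3) $\pi(\bar\gamma(t))=\gamma(t)$ for all $t\in[a,b]$; (4) any continuous path $\eta:[a,b]\to X$ satisfying (1), (2), (3) equals $\bar\gamma$; (5) $L(\bar\gamma)\le L(\gamma)$. $X_\infty$ is the set of $(x_i)_{i\in\mathbb{N}}\in\prod_i X_i$ with $\pi_{i+1}(x_{i+1})=x_i$ for all $i$ and $\sup_i d_i(\star_i,x_i)<\infty$, with metric $d_\infty(x,y)=\sup_i d_i(x_i,y_i)$; $\pi^\infty_i:X_\infty\to X_i$ is $(x_j)_j\mapsto x_i$.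 *)

theory Defs
  imports "HOL-Analysis.Analysis"
begin

text \<open>
  Metric spaces are given by a carrier and a distance function, as in the locale
  \<^locale>\<open>Metric_space\<close>. Only the values of maps on the carriers, and of paths on their
  parameter interval, are relevant.
\<close>

definition path_on :: "'a set \<Rightarrow> ('a \<Rightarrow> 'a \<Rightarrow> real) \<Rightarrow> real \<Rightarrow> real \<Rightarrow> (real \<Rightarrow> 'a) \<Rightarrow> bool" where
  "path_on M d a b \<gamma> \<longleftrightarrow>
     a \<le> b \<and> continuous_map (top_of_set {a..b}) (Metric_space.mtopology M d) \<gamma>"

definition partitions :: "real \<Rightarrow> real \<Rightarrow> (nat \<times> (nat \<Rightarrow> real)) set" where
  "partitions a b = {(n, t). t 0 = a \<and> t n = b \<and> (\<forall>k<n. t k \<le> t (Suc k))}"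

definition path_length :: "('a \<Rightarrow> 'a \<Rightarrow> real) \<Rightarrow> real \<Rightarrow> real \<Rightarrow> (real \<Rightarrow> 'a) \<Rightarrow> ennreal" where
  "path_length d a b \<gamma> =
     (SUP (n, t) \<in> partitions a b. ennreal (\<Sum>k<n. d (\<gamma> (t k)) (\<gamma> (t (Suc k)))))"

definition submetry ::
  "'a set \<Rightarrow> ('a \<Rightarrow> 'a \<Rightarrow> real) \<Rightarrow> 'b set \<Rightarrow> ('b \<Rightarrow> 'b \<Rightarrow> real) \<Rightarrow> ('a \<Rightarrow> 'b) \<Rightarrow> bool" where
  "submetry X dX Y dY \<pi> \<longleftrightarrow>
     Metric_space X dX \<and> X \<noteq> {} \<and> Metric_space Y dY \<and> Y \<noteq> {} \<and>
     \<pi> \<in> X \<rightarrow> Y \<and>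
     (\<forall>x\<in>X. \<forall>x'\<in>X. dY (\<pi> x) (\<pi> x') \<le> dX x x') \<and>
     (\<forall>y\<in>Y. \<forall>y'\<in>Y. \<forall>x\<in>X. \<pi> x = y \<longrightarrow> (\<exists>x'\<in>X. \<pi> x' = y' \<and> dX x x' = dY y y'))"

definition rectifiable_lift ::
  "'a set \<Rightarrow> ('a \<Rightarrow> 'a \<Rightarrow> real) \<Rightarrow> ('a \<Rightarrow> 'b) \<Rightarrow> real \<Rightarrow> real \<Rightarrow> (real \<Rightarrow> 'b) \<Rightarrow> 'a \<Rightarrow> (real \<Rightarrow> 'a) \<Rightarrow> bool" where
  "rectifiable_lift X dX \<pi> a b \<gamma> x \<eta> \<longleftrightarrow>
     path_on X dX a b \<eta> \<and> path_length dX a b \<eta> < \<infinity> \<and> \<eta> a = x \<and> (\<forall>t\<in>{a..b}. \<pi> (\<eta> t) = \<gamma> t)"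

definition unique_path_lifting ::
  "'a set \<Rightarrow> ('a \<Rightarrow> 'a \<Rightarrow> real) \<Rightarrow> 'b set \<Rightarrow> ('b \<Rightarrow> 'b \<Rightarrow> real) \<Rightarrow> ('a \<Rightarrow> 'b) \<Rightarrow> bool" where
  "unique_path_lifting X dX Y dY \<pi> \<longleftrightarrow>
     submetry X dX Y dY \<pi> \<and>
     (\<forall>a b \<gamma> x.
        path_on Y dY a b \<gamma> \<and> path_length dY a b \<gamma> < \<infinity> \<and> x \<in> X \<and> \<pi> x = \<gamma> a \<longrightarrow>
        (\<exists>\<gamma>'. rectifiable_lift X dX \<pi> a b \<gamma> x \<gamma>' \<and>
              (\<forall>\<eta>. rectifiable_lift X dX \<pi> a b \<gamma> x \<eta> \<longrightarrow> (\<forall>t\<in>{a..b}. \<eta> t = \<gamma>' t)) \<and>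
              path_length dX a b \<gamma>' \<le> path_length dY a b \<gamma>))"

text \<open>
  The index set is $\{1, 2, \dots\}$: sequences are functions on \<^typ>\<open>nat\<close> that are
  \<^const>\<open>undefined\<close> at \<open>0\<close>, and the bonding map into \<open>X i\<close> is \<open>\<pi> (Suc i)\<close> for \<open>i \<ge> 1\<close>.
\<close>

definition lim_space ::
  "(nat \<Rightarrow> 'a set) \<Rightarrow> (nat \<Rightarrow> 'a \<Rightarrow> 'a \<Rightarrow> real) \<Rightarrow> (nat \<Rightarrow> 'a) \<Rightarrow> (nat \<Rightarrow> 'a \<Rightarrow> 'a) \<Rightarrow> (nat \<Rightarrow> 'a) set" where
  "lim_space X d s \<pi> =
     {x \<in> \<Pi>\<^sub>E i\<in>{1..}. X i.
        (\<forall>i\<ge>1. \<pi> (Suc i) (x (Suc i)) = x i) \<and> bdd_above ((\<lambda>i. d i (s i) (x i)) ` {1..})}"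

text \<open>
  \<^locale>\<open>Metric_space\<close> asks for nonnegativity and symmetry on the whole type, so the distance
  is set to \<open>0\<close> off the carrier, where the supremum might not exist.
\<close>

definition lim_dist ::
  "(nat \<Rightarrow> 'a set) \<Rightarrow> (nat \<Rightarrow> 'a \<Rightarrow> 'a \<Rightarrow> real) \<Rightarrow> (nat \<Rightarrow> 'a) \<Rightarrow> (nat \<Rightarrow> 'a \<Rightarrow> 'a) \<Rightarrow>
   (nat \<Rightarrow> 'a) \<Rightarrow> (nat \<Rightarrow> 'a) \<Rightarrow> real" where
  "lim_dist X d s \<pi> x y =
     (if x \<in> lim_space X d s \<pi> \<and> y \<in> lim_space X d s \<pi> then SUP i\<in>{1..}. d i (x i) (y i) else 0)"

definition lim_proj :: "nat \<Rightarrow> (nat \<Rightarrow> 'a) \<Rightarrow> 'a" where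
  "lim_proj i x = x i"

end

theory Submission
  imports Defs
begin

text \<open>
  Let \<open>\<gamma>\<close> be a rectifiable path in \<open>X i\<close> and \<open>x\<close> a point of the limit over its start.
  Lifting \<open>\<gamma>\<close> step by step along the tower, with starting points \<open>x j\<close>, gives paths
  \<open>f j\<close> in \<open>X j\<close> for all \<open>j \<ge> i\<close>, none of them longer than \<open>\<gamma>\<close>. For each
  parameter \<open>t\<close> the points \<open>f j t\<close> are compatible and stay within bounded distance of
  \<open>x\<close>, so they are the coordinates of a point \<open>\<gamma>' t\<close> of the limit. Uniqueness of
  \<open>\<gamma>'\<close> is inherited coordinate by coordinate, because a coordinate of a rectifiable path in
  the limit is a rectifiable path.

  The point that needs an argument is continuity of \<open>\<gamma>'\<close>: the metric of the limit is a
  supremum, so the paths \<open>f j\<close> have to be equicontinuous. The bound on the length of the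
  whole lift is enough for this. Bonding maps do not increase distances, so no arc of a lift is
  shorter than the arc below it; as length is additive and the totals are finite, the lift then has
  no longer arc either (\<open>arcs_no_longer_if_path_no_longer\<close>). Hence the distance between
  \<open>f j u\<close> and \<open>f j v\<close> is at most the length of \<open>\<gamma>\<close> over \<open>[u, v]\<close>,
  uniformly in \<open>j\<close>, and the same bound holds for \<open>\<gamma>' u\<close> and \<open>\<gamma>' v\<close>. Short arcs
  of a continuous rectifiable path have small length (\<open>short_arcs\<close>), which gives continuity,
  and adding the bound over partitions gives that \<open>\<gamma>'\<close> is no longer than \<open>\<gamma>\<close>
  (\<open>path_of_dominated_chords\<close>).

  That the projections are submetries follows in the same way, lifting points instead of paths and
  preserving the distance to \<open>x j\<close> at every step.
\<close>

section \<open>Length of paths in a metric space\<close>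

lemma partition_mono:
  assumes "(n, t) \<in> partitions a b" "i \<le> j" "j \<le> n"
  shows "t i \<le> t j"
  using assms(2,3)
proof (induction j rule: dec_induct)
  case (step j)
  then have "t j \<le> t (Suc j)"
    using assms(1) by (auto simp: partitions_def)
  with step show ?case by simp
qed simp

lemma partition_range:
  assumes "(n, t) \<in> partitions a b" "k \<le> n"
  shows "t k \<in> {a..b}"
  using partition_mono[OF assms(1), of 0 k] partition_mono[OF assms(1), of k n] assms
  by (auto simp: partitions_def)

lemma partition_sum_le_path_length:
  assumes "(n, t) \<in> partitions a b"
  shows "ennreal (\<Sum>k<n. d (\<gamma> (t k)) (\<gamma> (t (Suc k)))) \<le> path_length d a b \<gamma>"
  unfolding path_length_def by (rule SUP_upper2[OF assms]) simp

lemma path_length_least: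
  assumes "\<And>n t. (n, t) \<in> partitions a b \<Longrightarrow>
             ennreal (\<Sum>k<n. d (\<gamma> (t k)) (\<gamma> (t (Suc k)))) \<le> c"
  shows "path_length d a b \<gamma> \<le> c"
  unfolding path_length_def using assms by (intro SUP_least) auto

lemma two_point_partition:
  assumes "u \<le> v"
  shows "(1, \<lambda>k. if k = 0 then u else v) \<in> partitions u v"
  using assms by (auto simp: partitions_def)

lemma dist_le_path_length:
  assumes "u \<le> v"
  shows "ennreal (d (\<gamma> u) (\<gamma> v)) \<le> path_length d u v \<gamma>"
  using partition_sum_le_path_length[OF two_point_partition[OF assms], of d \<gamma>] by simp

lemma path_length_superadditive:
  assumes nonneg: "\<And>x y. 0 \<le> d x y" and "a \<le> b" "b \<le> c"
  shows "path_length d a b \<gamma> + path_length d b c \<gamma> \<le> path_length d a c \<gamma>"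
proof -
  let ?S = "\<lambda>n t. ennreal (\<Sum>k<n. d (\<gamma> (t k)) (\<gamma> (t (Suc k))))"
  have concat: "?S n t + ?S m r \<le> path_length d a c \<gamma>"
    if t: "(n, t) \<in> partitions a b" and r: "(m, r) \<in> partitions b c" for n t m r
  proof -
    define q where "q k = (if k \<le> n then t k else r (k - n))" for k
    have q_shift: "q (n + k) = r k" for k
      using t r by (auto simp: q_def partitions_def)
    have "q k \<le> q (Suc k)" if "k < n + m" for k
    proof (cases "k < n")
      case True
      then show ?thesis using t by (auto simp: q_def partitions_def)
    next
      case False
      then obtain l where "k = n + l" using le_Suc_ex by (metis not_less)
      then show ?thesis
        using r that q_shift[of l] q_shift[of "Suc l"] by (auto simp: partitions_def)
    qed
    then have q: "(n + m, q) \<in> partitions a c"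
      using t r q_shift[of m] by (auto simp: partitions_def q_def)
    have "(\<Sum>k<n + m. d (\<gamma> (q k)) (\<gamma> (q (Suc k)))) =
        (\<Sum>k<n. d (\<gamma> (q k)) (\<gamma> (q (Suc k)))) + (\<Sum>k<m. d (\<gamma> (q (n + k))) (\<gamma> (q (n + Suc k))))"
      by (induction m) (simp_all add: add.assoc)
    also have "\<dots> = (\<Sum>k<n. d (\<gamma> (t k)) (\<gamma> (t (Suc k)))) + (\<Sum>k<m. d (\<gamma> (r k)) (\<gamma> (r (Suc k))))"
      unfolding q_shift by (simp add: q_def)
    finally have "?S n t + ?S m r = ?S (n + m) q"
      by (simp add: nonneg sum_nonneg)
    then show ?thesis
      using partition_sum_le_path_length[OF q] by simp
  qed
  have ne: "partitions a b \<noteq> {}" "partitions b c \<noteq> {}"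
    using two_point_partition assms(2,3) by blast+
  have "path_length d a b \<gamma> + path_length d b c \<gamma> =
      (SUP p \<in> partitions a b. (case p of (n, t) \<Rightarrow> ?S n t) + path_length d b c \<gamma>)"
    unfolding path_length_def by (rule ennreal_SUP_add_left[OF ne(1), symmetric])
  also have "\<dots> = (SUP p \<in> partitions a b. SUP p' \<in> partitions b c.
      (case p of (n, t) \<Rightarrow> ?S n t) + (case p' of (n, t) \<Rightarrow> ?S n t))"
    unfolding path_length_def by (simp only: ennreal_SUP_add_right[OF ne(2)])
  also have "\<dots> \<le> path_length d a c \<gamma>"
    by (intro SUP_least) (auto intro: concat)
  finally show ?thesis .
qed

text \<open>
  The chords of \<open>\<eta>\<close> over a partition are bounded by the lengths of the corresponding arcs of
  \<open>\<gamma>\<close>, and by superadditivity these arcs together are no longer than \<open>\<gamma>\<close>.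
\<close>
lemma path_length_dominated:
  assumes nonneg: "\<And>x y. 0 \<le> d x y" and nonneg': "\<And>x y. 0 \<le> d' x y"
    and chord: "\<And>u v. a \<le> u \<Longrightarrow> u \<le> v \<Longrightarrow> v \<le> b \<Longrightarrow> ennreal (d' (\<eta> u) (\<eta> v)) \<le> path_length d u v \<gamma>"
  shows "path_length d' a b \<eta> \<le> path_length d a b \<gamma>"
proof (rule path_length_least)
  fix n t
  assume p: "(n, t) \<in> partitions a b"
  have "ennreal (\<Sum>k<m. d' (\<eta> (t k)) (\<eta> (t (Suc k)))) \<le> path_length d (t 0) (t m) \<gamma>"
    if "m \<le> n" for m
    using that
  proof (induction m)
    case (Suc m)
    have le: "t 0 \<le> t m" "t m \<le> t (Suc m)"
      using partition_mono[OF p] Suc.prems by auto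
    have "ennreal (\<Sum>k<Suc m. d' (\<eta> (t k)) (\<eta> (t (Suc k)))) =
        ennreal (\<Sum>k<m. d' (\<eta> (t k)) (\<eta> (t (Suc k)))) + ennreal (d' (\<eta> (t m)) (\<eta> (t (Suc m))))"
      by (simp add: nonneg' sum_nonneg)
    also have "\<dots> \<le> path_length d (t 0) (t m) \<gamma> + path_length d (t m) (t (Suc m)) \<gamma>"
      using Suc partition_range[OF p, of m] partition_range[OF p, of "Suc m"] le
      by (intro add_mono chord) auto
    also have "\<dots> \<le> path_length d (t 0) (t (Suc m)) \<gamma>"
      using le by (intro path_length_superadditive nonneg)
    finally show ?case .
  qed simp
  from this[of n] p show "ennreal (\<Sum>k<n. d' (\<eta> (t k)) (\<eta> (t (Suc k)))) \<le> path_length d a b \<gamma>"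
    by (auto simp: partitions_def)
qed

lemma path_length_mono:
  assumes nonneg: "\<And>x y. 0 \<le> d x y" and nonneg': "\<And>x y. 0 \<le> d' x y"
    and le: "\<And>u v. u \<in> {a..b} \<Longrightarrow> v \<in> {a..b} \<Longrightarrow> d' (\<eta> u) (\<eta> v) \<le> d (\<gamma> u) (\<gamma> v)"
  shows "path_length d' a b \<eta> \<le> path_length d a b \<gamma>"
proof (rule path_length_dominated[OF nonneg nonneg'])
  fix u v :: real
  assume "a \<le> u" "u \<le> v" "v \<le> b"
  then show "ennreal (d' (\<eta> u) (\<eta> v)) \<le> path_length d u v \<gamma>"
    using order_trans[OF ennreal_leI[OF le[of u v]] dist_le_path_length[of u v d \<gamma>]] by auto
qed

text \<open>
  Cutting a partition at \<open>b\<close> by \<open>min\<close> and \<open>max\<close>, rather than inserting \<open>b\<close> as a new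
  point, keeps the number of points and makes the comparison of the sums termwise: only a step
  across \<open>b\<close> uses the triangle inequality.
\<close>
lemma (in Metric_space) partition_sum_split:
  assumes p: "(n, t) \<in> partitions a c" and \<gamma>: "\<gamma> \<in> {a..c} \<rightarrow> M" and b: "a \<le> b" "b \<le> c"
  shows "(n, \<lambda>k. min (t k) b) \<in> partitions a b"
    and "(n, \<lambda>k. max (t k) b) \<in> partitions b c"
    and "(\<Sum>k<n. d (\<gamma> (t k)) (\<gamma> (t (Suc k)))) \<le>
      (\<Sum>k<n. d (\<gamma> (min (t k) b)) (\<gamma> (min (t (Suc k)) b))) +
      (\<Sum>k<n. d (\<gamma> (max (t k) b)) (\<gamma> (max (t (Suc k)) b)))"
proof -
  show "(n, \<lambda>k. min (t k) b) \<in> partitions a b" "(n, \<lambda>k. max (t k) b) \<in> partitions b c"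
    using p b by (force simp: partitions_def)+
  have "d (\<gamma> (t k)) (\<gamma> (t (Suc k))) \<le>
      d (\<gamma> (min (t k) b)) (\<gamma> (min (t (Suc k)) b)) + d (\<gamma> (max (t k) b)) (\<gamma> (max (t (Suc k)) b))"
    if "k < n" for k
  proof -
    have "t k \<in> {a..c}" "t (Suc k) \<in> {a..c}"
      using partition_range[OF p] that by auto
    then have M: "\<gamma> (t k) \<in> M" "\<gamma> (t (Suc k)) \<in> M" "\<gamma> b \<in> M"
      using \<gamma> b by auto
    have "t k \<le> t (Suc k)"
      using p that by (auto simp: partitions_def)
    then show ?thesis
      using triangle[OF M(1,3,2)] M by (auto simp: min_def max_def)
  qed
  then show "(\<Sum>k<n. d (\<gamma> (t k)) (\<gamma> (t (Suc k)))) \<le>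
      (\<Sum>k<n. d (\<gamma> (min (t k) b)) (\<gamma> (min (t (Suc k)) b))) +
      (\<Sum>k<n. d (\<gamma> (max (t k) b)) (\<gamma> (max (t (Suc k)) b)))"
    unfolding sum.distrib[symmetric] by (intro sum_mono) auto
qed

lemma (in Metric_space) path_length_additive:
  assumes \<gamma>: "\<gamma> \<in> {a..c} \<rightarrow> M" and b: "a \<le> b" "b \<le> c"
  shows "path_length d a c \<gamma> = path_length d a b \<gamma> + path_length d b c \<gamma>"
proof (rule antisym)
  show "path_length d a c \<gamma> \<le> path_length d a b \<gamma> + path_length d b c \<gamma>"
  proof (rule path_length_least)
    fix n t
    assume p: "(n, t) \<in> partitions a c"
    note split = partition_sum_split[OF p \<gamma> b]
    have "ennreal (\<Sum>k<n. d (\<gamma> (t k)) (\<gamma> (t (Suc k)))) \<le>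
        ennreal (\<Sum>k<n. d (\<gamma> (min (t k) b)) (\<gamma> (min (t (Suc k)) b))) +
        ennreal (\<Sum>k<n. d (\<gamma> (max (t k) b)) (\<gamma> (max (t (Suc k)) b)))"
      using ennreal_leI[OF split(3)] by (simp add: sum_nonneg)
    also have "\<dots> \<le> path_length d a b \<gamma> + path_length d b c \<gamma>"
      by (intro add_mono partition_sum_le_path_length[OF split(1)]
            partition_sum_le_path_length[OF split(2)])
    finally show "ennreal (\<Sum>k<n. d (\<gamma> (t k)) (\<gamma> (t (Suc k)))) \<le>
        path_length d a b \<gamma> + path_length d b c \<gamma>" .
  qed
  show "path_length d a b \<gamma> + path_length d b c \<gamma> \<le> path_length d a c \<gamma>"
    using b by (intro path_length_superadditive) auto
qed

lemma (in Metric_space) path_length_additive3: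
  assumes \<gamma>: "\<gamma> \<in> {a..b} \<rightarrow> M" and uv: "a \<le> u" "u \<le> v" "v \<le> b"
  shows "path_length d a b \<gamma> =
    path_length d a u \<gamma> + (path_length d u v \<gamma> + path_length d v b \<gamma>)"
proof -
  have "\<gamma> \<in> {u..b} \<rightarrow> M" using \<gamma> uv by auto
  then show ?thesis
    using path_length_additive[of \<gamma> u b v] path_length_additive[OF \<gamma>, of u] uv by simp
qed

lemma (in Metric_space) path_on_iff:
  "path_on M d a b \<gamma> \<longleftrightarrow> a \<le> b \<and> \<gamma> \<in> {a..b} \<rightarrow> M \<and>
     (\<forall>t\<in>{a..b}. \<forall>e>0. \<exists>r>0. \<forall>u\<in>{a..b}. \<bar>u - t\<bar> < r \<longrightarrow> d (\<gamma> t) (\<gamma> u) < e)"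
proof -
  have "continuous_map (top_of_set {a..b}) mtopology \<gamma> \<longleftrightarrow> \<gamma> \<in> {a..b} \<rightarrow> M \<and>
     (\<forall>t\<in>{a..b}. \<forall>e>0. \<exists>r>0. \<forall>u\<in>{a..b}. \<bar>u - t\<bar> < r \<longrightarrow> d (\<gamma> t) (\<gamma> u) < e)" (is "?L \<longleftrightarrow> ?R")
  proof
    assume c: ?L
    then have M: "\<gamma> \<in> {a..b} \<rightarrow> M"
      by (auto simp: continuous_map_def Pi_iff)
    show ?R
    proof (intro conjI M ballI allI impI)
      fix t e :: real
      assume t: "t \<in> {a..b}" and "0 < e"
      then have "\<exists>U. openin (top_of_set {a..b}) U \<and> t \<in> U \<and> (\<forall>y\<in>U. \<gamma> y \<in> mball (\<gamma> t) e)"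
        using c unfolding continuous_map_to_metric by simp
      then obtain U where U: "openin (top_of_set {a..b}) U" "t \<in> U" "\<And>y. y \<in> U \<Longrightarrow> \<gamma> y \<in> mball (\<gamma> t) e"
        by blast
      then obtain r where "0 < r" "\<And>u. u \<in> {a..b} \<Longrightarrow> dist u t < r \<Longrightarrow> u \<in> U"
        unfolding openin_euclidean_subtopology_iff by metis
      then show "\<exists>r>0. \<forall>u\<in>{a..b}. \<bar>u - t\<bar> < r \<longrightarrow> d (\<gamma> t) (\<gamma> u) < e"
        using U(3) by (auto simp: dist_real_def)
    qed
  next
    assume R: ?R
    show ?L
      unfolding continuous_map_to_metric
    proof (intro ballI allI impI)
      fix t e :: real
      assume "t \<in> topspace (top_of_set {a..b})" "0 < e"
      then have t: "t \<in> {a..b}" by simp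
      with R \<open>0 < e\<close> obtain r where r: "0 < r" "\<And>u. u \<in> {a..b} \<Longrightarrow> \<bar>u - t\<bar> < r \<Longrightarrow> d (\<gamma> t) (\<gamma> u) < e"
        by meson
      have "openin (top_of_set {a..b}) ({a..b} \<inter> ball t r)"
        by (simp add: openin_open_Int)
      then show "\<exists>U. openin (top_of_set {a..b}) U \<and> t \<in> U \<and> (\<forall>y\<in>U. \<gamma> y \<in> mball (\<gamma> t) e)"
        using R r t by (intro exI[of _ "{a..b} \<inter> ball t r"])
          (auto simp: dist_real_def abs_minus_commute)
    qed
  qed
  then show ?thesis unfolding path_on_def by simp
qed

text \<open>
  Take a partition whose sum comes within \<open>e/4\<close> of the total length and cut it at \<open>u\<close> and
  \<open>v\<close>. The outer parts are at most the lengths over \<open>[a, u]\<close> and \<open>[v, b]\<close>, so the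
  length over \<open>[u, v]\<close> exceeds the middle sum by at most \<open>e/4\<close>. The middle sum has a fixed
  number of terms, each a distance between two points of \<open>\<gamma>\<close> near \<open>\<gamma> t\<close>, and is therefore
  small by continuity.
\<close>
lemma (in Metric_space) short_arcs:
  assumes \<gamma>: "path_on M d a b \<gamma>" "path_length d a b \<gamma> < \<infinity>" and t: "t \<in> {a..b}" and "0 < e"
  obtains r where "0 < r"
    "\<And>u v. \<lbrakk>a \<le> u; u \<le> v; v \<le> b; \<bar>u - t\<bar> < r; \<bar>v - t\<bar> < r\<rbrakk> \<Longrightarrow> path_length d u v \<gamma> < ennreal e"
proof -
  have M: "\<gamma> \<in> {a..b} \<rightarrow> M"
    using \<gamma>(1) by (simp add: path_on_iff)
  have "\<exists>n p. (n, p) \<in> partitions a b \<and>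
      path_length d a b \<gamma> \<le> ennreal (\<Sum>k<n. d (\<gamma> (p k)) (\<gamma> (p (Suc k)))) + ennreal (e/4)"
  proof (rule ccontr)
    assume neg: "\<not> ?thesis"
    then have "ennreal (\<Sum>k<n. d (\<gamma> (p k)) (\<gamma> (p (Suc k)))) \<le> path_length d a b \<gamma> - ennreal (e/4)"
      if "(n, p) \<in> partitions a b" for n p
      using that by (auto simp: not_le ennreal_le_minus_iff less_imp_le)
    then have "path_length d a b \<gamma> \<le> path_length d a b \<gamma> - ennreal (e/4)"
      by (rule path_length_least)
    \<comment> \<open>Subtracting \<open>e/4\<close> from a finite length makes it strictly smaller unless it is
      \<open>0\<close>, in which case every partition comes within \<open>e/4\<close>.\<close>
    moreover have "path_length d a b \<gamma> \<noteq> 0"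
      using neg two_point_partition[of a b] \<gamma>(1) by (fastforce simp: path_on_iff)
    ultimately show False
      using \<gamma>(2) \<open>0 < e\<close> ennreal_between[of "ennreal (e/4)"]
      by (auto simp: not_le[symmetric])
  qed
  then obtain n p where p: "(n, p) \<in> partitions a b"
    and near: "path_length d a b \<gamma> \<le> ennreal (\<Sum>k<n. d (\<gamma> (p k)) (\<gamma> (p (Suc k)))) + ennreal (e/4)"
    by blast
  \<comment> \<open>Each of the \<open>n\<close> middle terms will be at most \<open>2 * h\<close>, so their sum is at most
    \<open>e/4\<close>; the summand \<open>1\<close> covers \<open>n = 0\<close>.\<close>
  define h where "h = e / (8 * (real n + 1))"
  have "0 < h" using \<open>0 < e\<close> by (simp add: h_def)
  then obtain r where r: "0 < r" "\<And>w. w \<in> {a..b} \<Longrightarrow> \<bar>w - t\<bar> < r \<Longrightarrow> d (\<gamma> t) (\<gamma> w) < h"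
    using \<gamma>(1) t unfolding path_on_iff by meson
  show thesis
  proof (rule that[OF r(1)])
    fix u v
    assume uv: "a \<le> u" "u \<le> v" "v \<le> b" and close: "\<bar>u - t\<bar> < r" "\<bar>v - t\<bar> < r"
    let ?q = "\<lambda>k. max (p k) u"
    let ?m = "\<lambda>k. min (?q k) v"
    let ?S = "\<lambda>q. \<Sum>k<n. d (\<gamma> (q k)) (\<gamma> (q (Suc k)))"
    have Mu: "\<gamma> \<in> {u..b} \<rightarrow> M" using M uv by auto
    note s1 = partition_sum_split[OF p M, of u]
    have q: "(n, ?q) \<in> partitions u b" using s1(2) uv by simp
    note s2 = partition_sum_split[OF q Mu, of v]
    have "?S ?m \<le> (\<Sum>k<n. 2 * h)"
    proof (rule sum_mono)
      fix k assume "k \<in> {..<n}"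
      have near_t: "d (\<gamma> t) (\<gamma> w) < h" "\<gamma> w \<in> M" if "w \<in> {u..v}" for w
        using r(2)[of w] that uv close M by auto
      have m: "?m k \<in> {u..v}" for k
        using uv by auto
      have "\<gamma> t \<in> M" using M t by auto
      then have "d (\<gamma> (?m k)) (\<gamma> (?m (Suc k))) \<le> d (\<gamma> (?m k)) (\<gamma> t) + d (\<gamma> t) (\<gamma> (?m (Suc k)))"
        using near_t(2)[OF m] by (intro triangle)
      then show "d (\<gamma> (?m k)) (\<gamma> (?m (Suc k))) \<le> 2 * h"
        using near_t(1)[OF m, of k] near_t(1)[OF m, of "Suc k"] commute[of "\<gamma> t" "\<gamma> (?m k)"] by linarith
    qed
    also have "\<dots> \<le> e / 4"
      using \<open>0 < e\<close> by (simp add: h_def field_simps)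
    finally have mid: "?S ?m \<le> e / 4" .
    have "path_length d a u \<gamma> + (path_length d u v \<gamma> + path_length d v b \<gamma>) \<le> ennreal (?S p) + ennreal (e/4)"
      using near path_length_additive3[OF M uv] by simp
    also have "ennreal (?S p) \<le> ennreal (?S (\<lambda>k. min (p k) u) + (?S ?m + ?S (\<lambda>k. max (?q k) v)))"
      using s1(3) s2(3) uv by (intro ennreal_leI) auto
    also have "\<dots> = ennreal (?S (\<lambda>k. min (p k) u)) + (ennreal (?S ?m) + ennreal (?S (\<lambda>k. max (?q k) v)))"
      by (simp add: sum_nonneg)
    also have "\<dots> \<le> path_length d a u \<gamma> + (ennreal (e/4) + path_length d v b \<gamma>)"
      using s1(1) s2(2) uv mid by (intro add_mono partition_sum_le_path_length ennreal_leI) auto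
    finally have "(path_length d a u \<gamma> + path_length d v b \<gamma>) + path_length d u v \<gamma> \<le>
        (path_length d a u \<gamma> + path_length d v b \<gamma>) + (ennreal (e/4) + ennreal (e/4))"
      by (simp add: ac_simps)
    moreover have "path_length d a u \<gamma> + path_length d v b \<gamma> \<noteq> \<infinity>"
      using \<gamma>(2) path_length_additive3[OF M uv] by (auto simp: less_top[symmetric])
    ultimately have "path_length d u v \<gamma> \<le> ennreal (e/4) + ennreal (e/4)"
      by (simp add: ennreal_add_left_cancel_le)
    also have "\<dots> = ennreal (e/2)"
      using \<open>0 < e\<close> by (simp flip: ennreal_plus)
    also have "\<dots> < ennreal e"
      using \<open>0 < e\<close> by (simp add: ennreal_lessI)
    finally show "path_length d u v \<gamma> < ennreal e" .
  qed
qed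

text \<open>
  A bound on distances by the arc lengths of one fixed path survives a supremum of metrics, whereas
  moduli of continuity found separately for each metric do not. This makes it the right hypothesis
  for a path in the limit space; continuity then comes from short arcs having small length.
\<close>
lemma path_of_dominated_chords:
  assumes X: "Metric_space X d" and Y: "Metric_space Y d'"
    and \<gamma>: "path_on X d a b \<gamma>" "path_length d a b \<gamma> < \<infinity>" and \<eta>: "\<eta> \<in> {a..b} \<rightarrow> Y"
    and chord: "\<And>u v. a \<le> u \<Longrightarrow> u \<le> v \<Longrightarrow> v \<le> b \<Longrightarrow> ennreal (d' (\<eta> u) (\<eta> v)) \<le> path_length d u v \<gamma>"
  shows "path_on Y d' a b \<eta>" and "path_length d' a b \<eta> \<le> path_length d a b \<gamma>"
proof -
  interpret X: Metric_space X d by (rule X)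
  interpret Y: Metric_space Y d' by (rule Y)
  show "path_length d' a b \<eta> \<le> path_length d a b \<gamma>"
    by (intro path_length_dominated chord) auto
  show "path_on Y d' a b \<eta>"
    unfolding Y.path_on_iff
  proof (intro conjI \<eta> ballI allI impI)
    show "a \<le> b" using \<gamma>(1) by (simp add: path_on_def)
    fix t e :: real
    assume t: "t \<in> {a..b}" and "0 < e"
    obtain r where r: "0 < r" "\<And>u v. \<lbrakk>a \<le> u; u \<le> v; v \<le> b; \<bar>u - t\<bar> < r; \<bar>v - t\<bar> < r\<rbrakk>
        \<Longrightarrow> path_length d u v \<gamma> < ennreal e"
      using X.short_arcs[OF \<gamma> t \<open>0 < e\<close>] by blast
    have "d' (\<eta> t) (\<eta> u) < e" if u: "u \<in> {a..b}" "\<bar>u - t\<bar> < r" for u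
    proof -
      have "ennreal (d' (\<eta> (min t u)) (\<eta> (max t u))) < ennreal e"
        using chord[of "min t u" "max t u"] r(2)[of "min t u" "max t u"] t u r(1)
        by (auto simp: min_def max_def split: if_splits)
      then have "d' (\<eta> (min t u)) (\<eta> (max t u)) < e"
        by (simp add: ennreal_less_iff)
      then show ?thesis
        using Y.commute by (auto simp: min_def max_def split: if_splits)
    qed
    with r(1) show "\<exists>r>0. \<forall>u\<in>{a..b}. \<bar>u - t\<bar> < r \<longrightarrow> d' (\<eta> t) (\<eta> u) < e"
      by blast
  qed
qed

text \<open>
  A map that does not increase distances makes every arc of \<open>\<eta>\<close> at least as long as the
  corresponding arc of \<open>\<gamma>\<close>. If some arc were strictly longer, then by additivity and
  finiteness \<open>\<eta>\<close> as a whole would be longer than \<open>\<gamma>\<close>.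
\<close>
lemma arcs_no_longer_if_path_no_longer:
  assumes "Metric_space X d" "Metric_space Y d'"
    and \<gamma>: "\<gamma> \<in> {a..b} \<rightarrow> X" "path_length d a b \<gamma> < \<infinity>" and \<eta>: "\<eta> \<in> {a..b} \<rightarrow> Y"
    and lip: "\<And>u v. u \<in> {a..b} \<Longrightarrow> v \<in> {a..b} \<Longrightarrow> d (\<gamma> u) (\<gamma> v) \<le> d' (\<eta> u) (\<eta> v)"
    and no_longer: "path_length d' a b \<eta> \<le> path_length d a b \<gamma>"
    and uv: "a \<le> u" "u \<le> v" "v \<le> b"
  shows "path_length d' u v \<eta> \<le> path_length d u v \<gamma>"
proof -
  interpret X: Metric_space X d by fact
  interpret Y: Metric_space Y d' by fact
  note addX = X.path_length_additive3[OF \<gamma>(1) uv]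
  note addY = Y.path_length_additive3[OF \<eta> uv]
  have le: "path_length d u' v' \<gamma> \<le> path_length d' u' v' \<eta>" if "a \<le> u'" "v' \<le> b" for u' v'
    using that by (intro path_length_mono lip) auto
  have fin: "path_length d' a b \<eta> \<noteq> \<infinity>"
    using \<gamma>(2) no_longer by (auto simp: top_unique)
  have "path_length d' a u \<eta> + (path_length d' u v \<eta> + path_length d' v b \<eta>) \<le>
      path_length d a u \<gamma> + (path_length d u v \<gamma> + path_length d v b \<gamma>)"
    using no_longer addX addY by simp
  also have "\<dots> \<le> path_length d' a u \<eta> + (path_length d u v \<gamma> + path_length d' v b \<eta>)"
    using uv by (intro add_mono le) auto
  finally have "(path_length d' a u \<eta> + path_length d' v b \<eta>) + path_length d' u v \<eta> \<le>
      (path_length d' a u \<eta> + path_length d' v b \<eta>) + path_length d u v \<gamma>"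
    by (simp add: ac_simps)
  moreover have "path_length d' a u \<eta> + path_length d' v b \<eta> \<noteq> \<infinity>"
    using fin addY by auto
  ultimately show ?thesis
    by (simp add: ennreal_add_left_cancel_le)
qed

section \<open>The limit of a tower of submetries\<close>

lemma dependent_choice_from:
  assumes "P i x0" and "\<And>j x. i \<le> j \<Longrightarrow> P j x \<Longrightarrow> \<exists>y. P (Suc j) y \<and> Q j x y"
  obtains f where "f i = x0" "\<And>j. i \<le> j \<Longrightarrow> P j (f j)" "\<And>j. i \<le> j \<Longrightarrow> Q j (f j) (f (Suc j))"
proof -
  have "\<exists>g. \<forall>k. (P (i + k) (g k) \<and> (k = 0 \<longrightarrow> g k = x0)) \<and> Q (i + k) (g k) (g (Suc k))"
    using assms by (intro dependent_nat_choice) auto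
  then obtain g where g: "\<And>k. P (i + k) (g k)" "g 0 = x0" "\<And>k. Q (i + k) (g k) (g (Suc k))"
    by auto
  show thesis
  proof (rule that[of "\<lambda>j. g (j - i)"])
    fix j assume "i \<le> j"
    then show "P j (g (j - i))" "Q j (g (j - i)) (g (Suc j - i))"
      using g(1,3)[of "j - i"] by (auto simp: Suc_diff_le)
  qed (simp add: g(2))
qed

locale pointed_tower =
  fixes X :: "nat \<Rightarrow> 'a set"
    and d :: "nat \<Rightarrow> 'a \<Rightarrow> 'a \<Rightarrow> real"
    and s :: "nat \<Rightarrow> 'a"
    and \<pi> :: "nat \<Rightarrow> 'a \<Rightarrow> 'a"
  assumes metric: "i \<ge> 1 \<Longrightarrow> Metric_space (X i) (d i)"
    and base: "i \<ge> 1 \<Longrightarrow> s i \<in> X i"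
    and base_map: "i \<ge> 1 \<Longrightarrow> \<pi> (Suc i) (s (Suc i)) = s i"
    and bonding: "i \<ge> 1 \<Longrightarrow> submetry (X (Suc i)) (d (Suc i)) (X i) (d i) (\<pi> (Suc i))"
begin

abbreviation L where "L \<equiv> lim_space X d s \<pi>"
abbreviation D where "D \<equiv> lim_dist X d s \<pi>"

lemma bonding_in: "i \<ge> 1 \<Longrightarrow> x \<in> X (Suc i) \<Longrightarrow> \<pi> (Suc i) x \<in> X i"
  using bonding unfolding submetry_def by blast

lemma bonding_lipschitz:
  "i \<ge> 1 \<Longrightarrow> x \<in> X (Suc i) \<Longrightarrow> y \<in> X (Suc i) \<Longrightarrow> d i (\<pi> (Suc i) x) (\<pi> (Suc i) y) \<le> d (Suc i) x y"
  using bonding unfolding submetry_def by blast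

lemma lim_space_in: "x \<in> L \<Longrightarrow> i \<ge> 1 \<Longrightarrow> x i \<in> X i"
  by (auto simp: lim_space_def)

lemma lim_space_compatible: "x \<in> L \<Longrightarrow> i \<ge> 1 \<Longrightarrow> \<pi> (Suc i) (x (Suc i)) = x i"
  by (auto simp: lim_space_def)

lemma lim_space_bounded: "x \<in> L \<Longrightarrow> \<exists>A. \<forall>i\<ge>1. d i (s i) (x i) \<le> A"
  by (auto simp: lim_space_def bdd_above_def)

lemma base_in_lim_space: "restrict s {1..} \<in> L"
proof -
  have "d i (s i) (s i) = 0" if "i \<ge> 1" for i
    using Metric_space.mdist_zero[OF metric base] that by simp
  then show ?thesis
    using base base_map by (auto simp: lim_space_def intro!: bdd_aboveI2[of _ _ 0])
qed

lemma bdd_above_dist: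
  assumes "x \<in> L" "y \<in> L"
  shows "bdd_above ((\<lambda>i. d i (x i) (y i)) ` {1..})"
proof -
  obtain A B where A: "\<And>i. i \<ge> 1 \<Longrightarrow> d i (s i) (x i) \<le> A" and B: "\<And>i. i \<ge> 1 \<Longrightarrow> d i (s i) (y i) \<le> B"
    using assms[THEN lim_space_bounded] by blast
  show ?thesis
  proof (rule bdd_aboveI2)
    fix i :: nat assume "i \<in> {1..}"
    then have i: "i \<ge> 1" by simp
    interpret Metric_space "X i" "d i" by (rule metric[OF i])
    have "d i (x i) (y i) \<le> d i (x i) (s i) + d i (s i) (y i)"
      using assms i by (intro triangle lim_space_in base)
    also have "\<dots> \<le> A + B"
      using A[OF i] B[OF i] commute by (simp add: add_mono)
    finally show "d i (x i) (y i) \<le> A + B" .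
  qed
qed

lemma dist_le_lim_dist: "x \<in> L \<Longrightarrow> y \<in> L \<Longrightarrow> i \<ge> 1 \<Longrightarrow> d i (x i) (y i) \<le> D x y"
  unfolding lim_dist_def by (auto simp del: One_nat_def intro!: cSUP_upper bdd_above_dist)

lemma coordinate_dist_mono:
  assumes x: "\<And>j. j \<ge> 1 \<Longrightarrow> x j \<in> X j" "\<And>j. j \<ge> 1 \<Longrightarrow> \<pi> (Suc j) (x (Suc j)) = x j"
    and y: "\<And>j. j \<ge> 1 \<Longrightarrow> y j \<in> X j" "\<And>j. j \<ge> 1 \<Longrightarrow> \<pi> (Suc j) (y (Suc j)) = y j"
    and "1 \<le> i" "i \<le> j"
  shows "d i (x i) (y i) \<le> d j (x j) (y j)"
  using \<open>i \<le> j\<close>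
proof (induction j rule: dec_induct)
  case (step j)
  then have "1 \<le> j" using \<open>1 \<le> i\<close> by simp
  then show ?case
    using step.IH bonding_lipschitz[of j "x (Suc j)" "y (Suc j)"] x y by simp
qed simp

text \<open>
  Distances of coordinates increase along the tower, so any tail of coordinates already decides
  the supremum.
\<close>
lemma lim_dist_le:
  assumes xy: "x \<in> L" "y \<in> L" and i: "i \<ge> 1"
    and le: "\<And>j. j \<ge> i \<Longrightarrow> d j (x j) (y j) \<le> c"
  shows "D x y \<le> c"
proof -
  have "d j (x j) (y j) \<le> c" if "j \<ge> 1" for j
  proof (rule order_trans)
    show "d j (x j) (y j) \<le> d (max i j) (x (max i j)) (y (max i j))"
      using xy that by (intro coordinate_dist_mono) (auto intro: lim_space_in lim_space_compatible)
  qed (simp add: le)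
  then show ?thesis
    unfolding lim_dist_def using xy by (auto intro!: cSUP_least)
qed

lemma lim_metric: "Metric_space L D"
proof
  show nonneg: "0 \<le> D x y" for x y
  proof (cases "x \<in> L \<and> y \<in> L")
    case True
    then show ?thesis
      using dist_le_lim_dist[of x y 1] Metric_space.nonneg[OF metric[of 1], of "x 1" "y 1"] by simp
  qed (auto simp: lim_dist_def)
  show "D x y = D y x" for x y
  proof -
    have "d i (x i) (y i) = d i (y i) (x i)" if "i \<in> {1..}" for i
      using Metric_space.commute[OF metric] that by simp
    then show ?thesis
      unfolding lim_dist_def by (auto intro: SUP_cong)
  qed
  show "D x y = 0 \<longleftrightarrow> x = y" if xy: "x \<in> L" "y \<in> L" for x y
  proof
    assume D0: "D x y = 0"
    have "x i = y i" if i: "i \<ge> 1" for i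
    proof -
      interpret Metric_space "X i" "d i" by (rule metric[OF i])
      show ?thesis
        using dist_le_lim_dist[OF xy i] D0 nonneg[of "x i" "y i"] zero[of "x i" "y i"]
          lim_space_in[OF _ i] xy by simp
    qed
    moreover have "x \<in> extensional {1..}" "y \<in> extensional {1..}"
      using xy by (auto simp: lim_space_def PiE_def)
    ultimately show "x = y"
      by (auto intro: extensionalityI[of _ "{1..}"])
  next
    assume "x = y"
    then have "D x y \<le> 0"
      using xy Metric_space.mdist_zero[OF metric lim_space_in]
      by (intro lim_dist_le[of _ _ 1]) auto
    with nonneg show "D x y = 0" by (simp add: order_antisym)
  qed
  show "D x z \<le> D x y + D y z" if xyz: "x \<in> L" "y \<in> L" "z \<in> L" for x y z
  proof (rule lim_dist_le[OF xyz(1,3) order_refl])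
    fix j :: nat assume j: "1 \<le> j"
    have "d j (x j) (z j) \<le> d j (x j) (y j) + d j (y j) (z j)"
      using xyz j by (intro Metric_space.triangle[OF metric] lim_space_in)
    also have "\<dots> \<le> D x y + D y z"
      using xyz j by (intro add_mono dist_le_lim_dist)
    finally show "d j (x j) (z j) \<le> D x y + D y z" .
  qed
qed

text \<open>
  The missing coordinates are supplied one at a time, downwards, by the bonding maps.
\<close>
lemma extend_tail:
  assumes "1 \<le> i" "\<And>j. i \<le> j \<Longrightarrow> z j \<in> X j" "\<And>j. i \<le> j \<Longrightarrow> \<pi> (Suc j) (z (Suc j)) = z j"
  shows "\<exists>y. (\<forall>j\<ge>1. y j \<in> X j \<and> \<pi> (Suc j) (y (Suc j)) = y j) \<and> (\<forall>j\<ge>i. y j = z j)"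
  using assms
proof (induction i arbitrary: z rule: dec_induct)
  case base
  then show ?case by blast
next
  case (step i)
  let ?z = "z(i := \<pi> (Suc i) (z (Suc i)))"
  have "\<exists>y. (\<forall>j\<ge>1. y j \<in> X j \<and> \<pi> (Suc j) (y (Suc j)) = y j) \<and> (\<forall>j\<ge>i. y j = ?z j)"
  proof (rule step.IH)
    fix j assume "i \<le> j"
    then show "?z j \<in> X j" "\<pi> (Suc j) (?z (Suc j)) = ?z j"
      using step.prems step.hyps bonding_in[of i] by (cases "j = i"; simp)+
  qed
  then obtain y where y: "\<forall>j\<ge>1. y j \<in> X j \<and> \<pi> (Suc j) (y (Suc j)) = y j" "\<forall>j\<ge>i. y j = ?z j"
    by blast
  have "\<forall>j\<ge>Suc i. y j = z j"
    using y(2) by simp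
  with y(1) show ?case by blast
qed

text \<open>
  Distance from the base point can be controlled through a point \<open>x\<close> already known to lie in the
  limit; the coordinates below \<open>i\<close> obey the same bound because distances of coordinates
  increase along the tower.
\<close>
lemma lim_point_from_tail:
  assumes x: "x \<in> L" and i: "1 \<le> i"
    and z: "\<And>j. i \<le> j \<Longrightarrow> z j \<in> X j" "\<And>j. i \<le> j \<Longrightarrow> \<pi> (Suc j) (z (Suc j)) = z j"
    and le: "\<And>j. i \<le> j \<Longrightarrow> d j (x j) (z j) \<le> c"
  shows "\<exists>y\<in>L. \<forall>j\<ge>i. y j = z j"
proof -
  obtain y where y: "\<And>j. j \<ge> 1 \<Longrightarrow> y j \<in> X j" "\<And>j. j \<ge> 1 \<Longrightarrow> \<pi> (Suc j) (y (Suc j)) = y j"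
    and yz: "\<And>j. j \<ge> i \<Longrightarrow> y j = z j"
    using extend_tail[OF i z] by blast
  obtain A where A: "\<And>j. j \<ge> 1 \<Longrightarrow> d j (s j) (x j) \<le> A"
    using lim_space_bounded[OF x] by blast
  have "d j (s j) (y j) \<le> A + c" if j: "1 \<le> j" for j
  proof -
    have "d j (x j) (y j) \<le> d (max i j) (x (max i j)) (y (max i j))"
      using x y j by (intro coordinate_dist_mono) (auto intro: lim_space_in lim_space_compatible)
    also have "\<dots> \<le> c"
      using le by (simp add: yz)
    finally have "d j (x j) (y j) \<le> c" .
    moreover have "d j (s j) (y j) \<le> d j (s j) (x j) + d j (x j) (y j)"
      using Metric_space.triangle[OF metric base lim_space_in] x y(1) j by blast
    ultimately show ?thesis using A[OF j] by linarith
  qed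
  then have "restrict y {1..} \<in> L"
    using y by (auto simp: lim_space_def intro!: bdd_aboveI2[of _ _ "A + c"])
  moreover have "\<forall>j\<ge>i. restrict y {1..} j = z j"
    using yz i by auto
  ultimately show ?thesis by blast
qed

lemma lim_proj_submetry:
  assumes i: "1 \<le> i"
  shows "submetry L D (X i) (d i) (lim_proj i)"
  unfolding submetry_def
proof (intro conjI ballI impI)
  show "L \<noteq> {}" using base_in_lim_space by blast
  show "X i \<noteq> {}" using base[OF i] by blast
  show "lim_proj i \<in> L \<rightarrow> X i"
    using i by (auto simp: lim_proj_def lim_space_in)
  show "d i (lim_proj i x) (lim_proj i x') \<le> D x x'" if "x \<in> L" "x' \<in> L" for x x'
    using that i by (simp add: lim_proj_def dist_le_lim_dist)
  fix y y' x
  assume y: "y \<in> X i" "y' \<in> X i" and x: "x \<in> L" "lim_proj i x = y"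
  have xi: "x i = y" using x by (simp add: lim_proj_def)
  obtain z where z: "z i = y'" "\<And>j. i \<le> j \<Longrightarrow> z j \<in> X j \<and> d j (x j) (z j) = d i y y'"
    "\<And>j. i \<le> j \<Longrightarrow> \<pi> (Suc j) (z (Suc j)) = z j"
  proof (rule dependent_choice_from[of "\<lambda>j w. w \<in> X j \<and> d j (x j) w = d i y y'" i y' "\<lambda>j w w'. \<pi> (Suc j) w' = w"])
    show "y' \<in> X i \<and> d i (x i) y' = d i y y'" using xi y by simp
    fix j w
    assume j: "i \<le> j" and w: "w \<in> X j \<and> d j (x j) w = d i y y'"
    have j1: "1 \<le> j" "1 \<le> Suc j" using i j by auto
    have "\<exists>w'\<in>X (Suc j). \<pi> (Suc j) w' = w \<and> d (Suc j) (x (Suc j)) w' = d j (x j) w"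
      using bonding[OF j1(1)] w lim_space_in[OF x(1) j1(1)] lim_space_in[OF x(1) j1(2)]
        lim_space_compatible[OF x(1) j1(1)]
      unfolding submetry_def by blast
    then show "\<exists>w'. (w' \<in> X (Suc j) \<and> d (Suc j) (x (Suc j)) w' = d i y y') \<and> \<pi> (Suc j) w' = w"
      using w by auto
  qed blast
  obtain x' where x': "x' \<in> L" "\<And>j. j \<ge> i \<Longrightarrow> x' j = z j"
    using lim_point_from_tail[OF x(1) i, of z "d i y y'"] z by auto
  have "D x x' \<le> d i y y'"
    using x x' z by (intro lim_dist_le[OF _ _ i]) auto
  moreover have "d i y y' \<le> D x x'"
    using dist_le_lim_dist[OF x(1) x'(1) i] x'(2)[of i] z(1) xi by simp
  ultimately show "\<exists>x'\<in>L. lim_proj i x' = y' \<and> D x x' = d i y y'"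
    using x' z(1) by (intro bexI[of _ x']) (auto simp: lim_proj_def)
qed (use i in \<open>auto intro: lim_metric metric\<close>)

lemma lim_eqI:
  assumes xy: "x \<in> L" "y \<in> L" and i: "1 \<le> i" and eq: "\<And>j. i \<le> j \<Longrightarrow> x j = y j"
  shows "x = y"
proof -
  have "d j (x j) (y j) \<le> 0" if "i \<le> j" for j
    using eq[OF that] Metric_space.mdist_zero[OF metric lim_space_in[OF xy(2)]] that i by simp
  then have "D x y \<le> 0"
    by (intro lim_dist_le[OF xy i])
  then show ?thesis
    using Metric_space.nonneg[OF lim_metric, of x y] Metric_space.zero[OF lim_metric xy] by simp
qed

section \<open>Lifting paths to the limit\<close>

text \<open>
  Reading off a coordinate does not increase distances, so the coordinates of a competing lift
  are themselves competitors for the lifts between consecutive levels.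
\<close>
lemma coordinate_path:
  assumes \<eta>: "path_on L D a b \<eta>" and j: "1 \<le> j"
  shows "path_on (X j) (d j) a b (\<lambda>t. \<eta> t j)"
    and "path_length (d j) a b (\<lambda>t. \<eta> t j) \<le> path_length D a b \<eta>"
proof -
  have \<eta>': "a \<le> b" "\<eta> \<in> {a..b} \<rightarrow> L"
    "\<forall>t\<in>{a..b}. \<forall>e>0. \<exists>r>0. \<forall>u\<in>{a..b}. \<bar>u - t\<bar> < r \<longrightarrow> D (\<eta> t) (\<eta> u) < e"
    using \<eta> unfolding Metric_space.path_on_iff[OF lim_metric] by blast+
  have le: "d j (\<eta> t j) (\<eta> u j) \<le> D (\<eta> t) (\<eta> u)" if "t \<in> {a..b}" "u \<in> {a..b}" for t u
    using that \<eta>'(2) j by (intro dist_le_lim_dist) auto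
  show "path_length (d j) a b (\<lambda>t. \<eta> t j) \<le> path_length D a b \<eta>"
    by (intro path_length_mono le Metric_space.nonneg[OF lim_metric] Metric_space.nonneg[OF metric[OF j]])
  show "path_on (X j) (d j) a b (\<lambda>t. \<eta> t j)"
    unfolding Metric_space.path_on_iff[OF metric[OF j]]
  proof (intro conjI ballI allI impI)
    fix t e :: real assume t: "t \<in> {a..b}" and "0 < e"
    then obtain r where "0 < r" "\<And>u. u \<in> {a..b} \<Longrightarrow> \<bar>u - t\<bar> < r \<Longrightarrow> D (\<eta> t) (\<eta> u) < e"
      using \<eta>'(3) by meson
    then show "\<exists>r>0. \<forall>u\<in>{a..b}. \<bar>u - t\<bar> < r \<longrightarrow> d j (\<eta> t j) (\<eta> u j) < e"
      using le_less_trans[OF le[OF t]] by blast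
  qed (use \<eta>'(1,2) lim_space_in[OF _ j] in auto)
qed

lemma lim_proj_unique_path_lifting:
  assumes lifting: "\<And>j. j \<ge> 1 \<Longrightarrow> unique_path_lifting (X (Suc j)) (d (Suc j)) (X j) (d j) (\<pi> (Suc j))"
    and i: "1 \<le> i"
  shows "unique_path_lifting L D (X i) (d i) (lim_proj i)"
  unfolding unique_path_lifting_def
proof (intro conjI lim_proj_submetry i allI impI, elim conjE)
  fix a b \<gamma> x
  assume \<gamma>: "path_on (X i) (d i) a b \<gamma>" "path_length (d i) a b \<gamma> < \<infinity>"
    and x: "x \<in> L" and x\<gamma>: "lim_proj i x = \<gamma> a"
  have "a \<le> b" using \<gamma>(1) by (simp add: path_on_def)
  let ?len = "\<lambda>j. path_length (d j)"
  \<comment> \<open>\<open>P\<close> keeps a lift at level \<open>j\<close> liftable; \<open>Q\<close> records that the next path is its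
    unique lift and no longer than it.\<close>
  define P where "P j f \<longleftrightarrow> path_on (X j) (d j) a b f \<and> ?len j a b f < \<infinity> \<and> f a = x j" for j f
  define Q where "Q j f g \<longleftrightarrow> rectifiable_lift (X (Suc j)) (d (Suc j)) (\<pi> (Suc j)) a b f (x (Suc j)) g \<and>
      (\<forall>h. rectifiable_lift (X (Suc j)) (d (Suc j)) (\<pi> (Suc j)) a b f (x (Suc j)) h \<longrightarrow>
        (\<forall>t\<in>{a..b}. h t = g t)) \<and>
      ?len (Suc j) a b g \<le> ?len j a b f" for j f g
  obtain f where f: "f i = \<gamma>" "\<And>j. i \<le> j \<Longrightarrow> P j (f j)" "\<And>j. i \<le> j \<Longrightarrow> Q j (f j) (f (Suc j))"
  proof (rule dependent_choice_from[of P i \<gamma> Q])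
    show "P i \<gamma>" using \<gamma> x\<gamma> by (simp add: P_def lim_proj_def)
    fix j g
    assume "i \<le> j" and g: "P j g"
    then have j: "1 \<le> j" using i by simp
    have "x (Suc j) \<in> X (Suc j)" "\<pi> (Suc j) (x (Suc j)) = g a"
      using lim_space_in[OF x] lim_space_compatible[OF x j] g by (auto simp: P_def)
    then obtain h where "Q j g h"
      using lifting[OF j] g unfolding unique_path_lifting_def P_def Q_def by blast
    then show "\<exists>h. P (Suc j) h \<and> Q j g h"
      unfolding P_def Q_def rectifiable_lift_def by blast
  qed blast
  have f_in: "f j \<in> {a..b} \<rightarrow> X j" if "i \<le> j" for j
    using f(2)[OF that] Metric_space.path_on_iff[OF metric[of j]] that i by (auto simp: P_def)
  have f_map: "\<pi> (Suc j) (f (Suc j) t) = f j t" if "i \<le> j" "t \<in> {a..b}" for j t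
    using f(3)[OF that(1)] that(2) by (auto simp: Q_def rectifiable_lift_def)
  \<comment> \<open>Uniformity in \<open>j\<close> of this bound is what makes the limit path continuous.\<close>
  have arc: "?len j u v (f j) \<le> ?len i u v \<gamma>"
    if "i \<le> j" and uv: "a \<le> u" "u \<le> v" "v \<le> b" for j u v
    using that(1)
  proof (induction j rule: dec_induct)
    case (step j)
    then have j: "1 \<le> j" "i \<le> j" "i \<le> Suc j" using i by auto
    have "?len (Suc j) u v (f (Suc j)) \<le> ?len j u v (f j)"
    proof (rule arcs_no_longer_if_path_no_longer[OF metric metric f_in _ f_in _ _ uv])
      fix u v assume uv: "u \<in> {a..b}" "v \<in> {a..b}"
      show "d j (f j u) (f j v) \<le> d (Suc j) (f (Suc j) u) (f (Suc j) v)"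
        using bonding_lipschitz[OF j(1) funcset_mem[OF f_in[OF j(3)] uv(1)] funcset_mem[OF f_in[OF j(3)] uv(2)]]
        unfolding f_map[OF j(2) uv(1)] f_map[OF j(2) uv(2)] .
    qed (use j f(2,3)[OF j(2)] in \<open>auto simp: P_def Q_def\<close>)
    with step.IH show ?case by simp
  qed (simp add: f(1))
  have arc_finite: "?len i u v \<gamma> < \<infinity>" if "a \<le> u" "u \<le> v" "v \<le> b" for u v
    using Metric_space.path_length_additive3[OF metric[OF i] f_in[OF order_refl] that] \<gamma>(2)
    by (auto simp: f(1) less_top[symmetric])
  have chord: "d j (f j u) (f j v) \<le> enn2real (?len i u v \<gamma>)"
    if "i \<le> j" and uv: "a \<le> u" "u \<le> v" "v \<le> b" for j u v
  proof -
    have "ennreal (d j (f j u) (f j v)) \<le> ?len i u v \<gamma>"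
      using dist_le_path_length[OF uv(2)] arc[OF that] by (rule order_trans)
    also have "\<dots> = ennreal (enn2real (?len i u v \<gamma>))"
      using arc_finite[OF uv] by simp
    finally show ?thesis by (simp add: ennreal_le_iff)
  qed
  have "\<exists>y\<in>L. \<forall>j\<ge>i. y j = f j t" if t: "t \<in> {a..b}" for t
  proof (rule lim_point_from_tail[OF x i])
    fix j assume j: "i \<le> j"
    show "f j t \<in> X j" "\<pi> (Suc j) (f (Suc j) t) = f j t"
      using f_in[OF j] f_map[OF j t] t by auto
    show "d j (x j) (f j t) \<le> enn2real (?len i a t \<gamma>)"
      using chord[OF j, of a t] t f(2)[OF j] by (auto simp: P_def)
  qed
  then obtain \<gamma>' where \<gamma>': "\<And>t. t \<in> {a..b} \<Longrightarrow> \<gamma>' t \<in> L" "\<And>t j. t \<in> {a..b} \<Longrightarrow> i \<le> j \<Longrightarrow> \<gamma>' t j = f j t"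
    by metis
  have lim_chord: "ennreal (D (\<gamma>' u) (\<gamma>' v)) \<le> ?len i u v \<gamma>" if "a \<le> u" "u \<le> v" "v \<le> b" for u v
  proof -
    have "D (\<gamma>' u) (\<gamma>' v) \<le> enn2real (?len i u v \<gamma>)"
      using that by (intro lim_dist_le[OF _ _ i]) (auto simp: \<gamma>' chord)
    then have "ennreal (D (\<gamma>' u) (\<gamma>' v)) \<le> ennreal (enn2real (?len i u v \<gamma>))"
      by (rule ennreal_leI)
    with arc_finite[OF that] show ?thesis by simp
  qed
  have \<gamma>'_in: "\<gamma>' \<in> {a..b} \<rightarrow> L" using \<gamma>'(1) by auto
  have path: "path_on L D a b \<gamma>'" "path_length D a b \<gamma>' \<le> ?len i a b \<gamma>"
    by (rule path_of_dominated_chords[OF metric[OF i] lim_metric \<gamma> \<gamma>'_in], erule (2) lim_chord)+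
  have "\<gamma>' a = x"
    using \<open>a \<le> b\<close> f(2) by (intro lim_eqI[OF _ x i]) (auto simp: \<gamma>' P_def)
  then have lift: "rectifiable_lift L D (lim_proj i) a b \<gamma> x \<gamma>'"
    using path \<gamma>(2) \<gamma>'(2) f(1) by (auto simp: rectifiable_lift_def lim_proj_def)
  have unique: "\<eta> t = \<gamma>' t"
    if \<eta>: "rectifiable_lift L D (lim_proj i) a b \<gamma> x \<eta>" and t: "t \<in> {a..b}" for \<eta> t
  proof -
    have path\<eta>: "path_on L D a b \<eta>" "path_length D a b \<eta> < \<infinity>" "\<eta> a = x"
      and proj: "\<And>t. t \<in> {a..b} \<Longrightarrow> \<eta> t i = \<gamma> t"
      using \<eta> by (auto simp: rectifiable_lift_def lim_proj_def)
    have \<eta>L: "\<eta> t \<in> L" if "t \<in> {a..b}" for t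
      using path\<eta>(1) that unfolding Metric_space.path_on_iff[OF lim_metric] by auto
    \<comment> \<open>Once the coordinate \<open>j\<close> of \<open>\<eta>\<close> is known to be \<open>f j\<close>, the coordinate
      \<open>Suc j\<close> is a rectifiable lift of \<open>f j\<close> and so must be \<open>f (Suc j)\<close>.\<close>
    have "\<forall>t\<in>{a..b}. \<eta> t j = f j t" if "i \<le> j" for j
      using that
    proof (induction j rule: dec_induct)
      case base
      then show ?case using proj f(1) by simp
    next
      case (step j)
      then have j: "1 \<le> j" "1 \<le> Suc j" using i by auto
      have "path_length (d (Suc j)) a b (\<lambda>t. \<eta> t (Suc j)) < \<infinity>"
        using coordinate_path(2)[OF path\<eta>(1) j(2)] path\<eta>(2) by (rule le_less_trans)
      then have "rectifiable_lift (X (Suc j)) (d (Suc j)) (\<pi> (Suc j)) a b (f j) (x (Suc j)) (\<lambda>t. \<eta> t (Suc j))"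
        using coordinate_path(1)[OF path\<eta>(1) j(2)] path\<eta>(3) step.IH lim_space_compatible[OF \<eta>L j(1)]
        by (auto simp: rectifiable_lift_def)
      then show ?case
        using f(3)[OF step.hyps(1)] unfolding Q_def by blast
    qed
    then show ?thesis
      using t by (intro lim_eqI[OF _ _ i]) (auto simp: \<eta>L \<gamma>')
  qed
  show "\<exists>\<gamma>'. rectifiable_lift L D (lim_proj i) a b \<gamma> x \<gamma>' \<and>
      (\<forall>\<eta>. rectifiable_lift L D (lim_proj i) a b \<gamma> x \<eta> \<longrightarrow> (\<forall>t\<in>{a..b}. \<eta> t = \<gamma>' t)) \<and>
      path_length D a b \<gamma>' \<le> path_length (d i) a b \<gamma>"
    using lift unique path(2) by blast
qed

end

theorem lemma2p7:
  fixes X :: "nat \<Rightarrow> 'a set"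
    and d :: "nat \<Rightarrow> 'a \<Rightarrow> 'a \<Rightarrow> real"
    and s :: "nat \<Rightarrow> 'a"
    and \<pi> :: "nat \<Rightarrow> 'a \<Rightarrow> 'a"
  assumes "\<And>i. i \<ge> 1 \<Longrightarrow> Metric_space (X i) (d i)"
    and "\<And>i. i \<ge> 1 \<Longrightarrow> s i \<in> X i"
    and "\<And>i. i \<ge> 1 \<Longrightarrow> \<pi> (Suc i) (s (Suc i)) = s i"
    and "\<And>i. i \<ge> 1 \<Longrightarrow> unique_path_lifting (X (Suc i)) (d (Suc i)) (X i) (d i) (\<pi> (Suc i))"
  shows "\<forall>i\<ge>1. unique_path_lifting (lim_space X d s \<pi>) (lim_dist X d s \<pi>) (X i) (d i) (lim_proj i)"
proof -
  interpret pointed_tower X d s \<pi>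
    using assms by (simp add: pointed_tower_def unique_path_lifting_def)
  show ?thesis
    using lim_proj_unique_path_lifting assms(4) by blast
qed

end
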